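(* For every fixed integer $l_0>0$ there exists a constant $\mathcal{C}=\mathcal{C}(l_0)>0$ such that, as $x\to\infty$, $$\sum_{n\leq x}\phi(n)\phi(n+l_0)\geq (1+o(1))\frac{9}{2\pi^4}\frac{x^3}{\mathcal{C}(l_0)}.$$
   Context: $\phi$ is Euler's totient function. The sum is over positive integers $n$, and $o(1)$ denotes a quantity tending to $0$ as $x\to\infty$. *)

theory Defs
  imports Complex_Main "HOL-Number_Theory.Totient" "HOL-Library.Landau_Symbols"
begin

end

theory Submission imports Defs begin

text \<open>
  Since \<open>1 - 1/p \<ge> exp (- 2/p)\<close> for \<open>p \<ge> 2\<close>, the product formula gives
  \<open>\<phi>(n) \<ge> n exp (- 2 g(n))\<close>, where \<open>g(n)\<close> is the sum of the reciprocals of the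
  primes dividing \<open>n\<close>. The mean value of \<open>g\<close> is at most \<open>\<Sum>p. 1/p\<^sup>2 \<le> 1\<close>, hence that of
  \<open>g(n) + g(n + l0)\<close> is bounded, and convexity of the exponential bounds the sum of
  \<open>\<phi>(n) \<phi>(n + l0)\<close> over \<open>N/2 < n \<le> N\<close> from below by a constant times \<open>N\<^sup>3\<close>. The
  constant \<open>C\<close> then absorbs everything, and the error term can be taken to be zero.
\<close>

definition prime_recip_sum :: "nat \<Rightarrow> real" where
  "prime_recip_sum n = (\<Sum>p\<in>prime_factors n. 1 / real p)"

lemma prime_recip_sum_nonneg: "prime_recip_sum n \<ge> 0"
  by (simp add: prime_recip_sum_def sum_nonneg)

lemma exp_le_one_minus:
  fixes x :: real
  assumes "0 \<le> x" "x \<le> 1 / 2"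
  shows "exp (- 2 * x) \<le> 1 - x"
proof -
  have "x * x \<le> x * (1 / 2)"
    using assms by (intro mult_left_mono) auto
  hence "- 2 * x \<le> - x - 2 * x\<^sup>2"
    by (simp add: power2_eq_square)
  also have "\<dots> \<le> ln (1 - x)"
    using assms by (rule ln_one_minus_pos_lower_bound)
  finally have "exp (- 2 * x) \<le> exp (ln (1 - x))"
    by simp
  thus ?thesis using assms by simp
qed

lemma totient_ge_exp: "real (totient n) \<ge> real n * exp (- 2 * prime_recip_sum n)"
proof -
  have "exp (- 2 * prime_recip_sum n) = (\<Prod>p\<in>prime_factors n. exp (- 2 * (1 / real p)))"
    unfolding prime_recip_sum_def sum_distrib_left by (rule exp_sum) simp
  also have "\<dots> \<le> (\<Prod>p\<in>prime_factors n. 1 - 1 / real p)"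
  proof (intro prod_mono conjI)
    fix p assume "p \<in> prime_factors n"
    hence "p \<ge> 2" by (auto intro: prime_ge_2_nat)
    thus "exp (- 2 * (1 / real p)) \<le> 1 - 1 / real p"
      by (intro exp_le_one_minus) (auto simp: field_simps)
  qed simp
  finally show ?thesis
    by (simp add: totient_formula2 mult_left_mono)
qed

lemma sum_inverse_squares_le: "(\<Sum>k=2..n. 1 / (real k)\<^sup>2) \<le> 1"
proof (cases "n = 0")
  case False
  hence "n > 0" by simp
  \<comment> \<open>The sharper bound lets the induction telescope; at \<open>n = 1\<close> both
    sides are 0.\<close>
  hence "(\<Sum>k=2..n. 1 / (real k)\<^sup>2) \<le> 1 - 1 / real n"
  proof (induction n rule: nat_induct_non_zero)
    case (Suc n)
    have "1 / (real (Suc n))\<^sup>2 \<le> 1 / real n - 1 / real (Suc n)"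
      using Suc.hyps by (simp add: divide_simps power2_eq_square)
    thus ?case using Suc by simp
  qed simp
  also have "\<dots> \<le> 1" by simp
  finally show ?thesis .
qed simp

text \<open>After interchanging the sums, each \<open>k\<close> has at most \<open>N / k\<close>
  multiples up to \<open>N\<close>, each of weight \<open>1 / k\<close>, which leaves
  \<open>N\<close> times a sum of inverse squares.\<close>

lemma sum_prime_recip_sum_le: "(\<Sum>n=1..N. prime_recip_sum n) \<le> real N"
proof -
  \<comment> \<open>Passing from prime divisors to all divisors \<open>k\<close> \<ge> 2 only adds
    nonnegative terms, and the inverse squares still sum to at most 1.\<close>
  have "(\<Sum>n=1..N. prime_recip_sum n) \<le> (\<Sum>n=1..N. \<Sum>k\<in>{k\<in>{2..N}. k dvd n}. 1 / real k)"
    unfolding prime_recip_sum_def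
    by (intro sum_mono sum_mono2)
       (auto simp: prime_factors_dvd dest: prime_ge_2_nat intro: order.trans[OF dvd_imp_le])
  also have "\<dots> = (\<Sum>k=2..N. \<Sum>n\<in>{n\<in>{1..N}. k dvd n}. 1 / real k)"
    by (rule sum.swap_restrict) auto
  also have "\<dots> \<le> (\<Sum>k=2..N. real N * (1 / (real k)\<^sup>2))"
  proof (rule sum_mono)
    fix k assume "k \<in> {2..N}"
    have "{n\<in>{1..N}. k dvd n} \<subseteq> (\<lambda>j. k * j) ` {1..N div k}"
      by (auto simp: dvd_def less_eq_div_iff_mult_less_eq mult.commute)
    hence "card {n\<in>{1..N}. k dvd n} \<le> N div k"
      using surj_card_le[of "{1..N div k}"] by simp
    hence "real (card {n\<in>{1..N}. k dvd n}) \<le> real N / real k"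
      by (meson of_nat_div_le_of_nat of_nat_mono order.trans)
    from mult_right_mono[OF this, of "1 / real k"]
    show "(\<Sum>n\<in>{n\<in>{1..N}. k dvd n}. 1 / real k) \<le> real N * (1 / (real k)\<^sup>2)"
      by (simp add: power2_eq_square)
  qed
  also have "\<dots> \<le> real N"
    unfolding sum_distrib_left[symmetric] using sum_inverse_squares_le[of N]
    by (intro mult_left_le) auto
  finally show ?thesis .
qed

lemma sum_totient_shift_ge:
  assumes "l \<le> N"
  shows "(\<Sum>n=1..N. real (totient n) * real (totient (n + l))) \<ge> exp (- 12) / 8 * real N ^ 3"
proof -
  define h where "h n = 2 * (prime_recip_sum n + prime_recip_sum (n + l))" for n
  \<comment> \<open>On the upper half both factors \<open>n\<close> and \<open>n + l\<close> are at
    least \<open>N / 2\<close>, and at least \<open>N / 2\<close> terms remain.\<close>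
  define A where "A = {N div 2<..N}"
  have A: "finite A" "A \<subseteq> {1..N}" by (auto simp: A_def)
  have card_A: "real (card A) \<ge> real N / 2"
    unfolding A_def by simp
  have "(\<Sum>n=1..N. prime_recip_sum (n + l)) = (\<Sum>n\<in>{1+l..N+l}. prime_recip_sum n)"
    by (simp only: sum.shift_bounds_cl_nat_ivl)
  also have "\<dots> \<le> (\<Sum>n=1..N+l. prime_recip_sum n)"
    by (intro sum_mono2) (auto simp: prime_recip_sum_nonneg)
  also have "\<dots> \<le> real (N + l)" by (rule sum_prime_recip_sum_le)
  \<comment> \<open>The two sums give \<open>N + (N + l)\<close> \<le> \<open>3 * N\<close>, doubled
    by the factor 2 in \<open>h\<close>.\<close>
  finally have "(\<Sum>n=1..N. h n) \<le> 6 * real N"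
    using sum_prime_recip_sum_le[of N] assms
    by (simp add: h_def sum_distrib_left[symmetric] sum.distrib)
  moreover have "(\<Sum>n\<in>A. h n) \<le> (\<Sum>n=1..N. h n)"
    using A by (intro sum_mono2) (auto simp: h_def prime_recip_sum_nonneg)
  ultimately have sum_h: "(\<Sum>n\<in>A. h n) \<le> 6 * real N" by linarith

  \<comment> \<open>Since \<open>A\<close> has at least \<open>N / 2\<close> elements,
    \<open>h\<close> averages at most 12 there, so \<open>13 - h n\<close> averages at least
    1.\<close>
  have "exp (- 12) / 8 * real N ^ 3 = (real N / 2)\<^sup>2 * exp (- 12) * (13 * (real N / 2) - 6 * real N)"
    by (simp add: power2_eq_square power3_eq_cube)
  also have "\<dots> \<le> (real N / 2)\<^sup>2 * exp (- 12) * (\<Sum>n\<in>A. 13 - h n)"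
    using card_A sum_h by (intro mult_left_mono) (auto simp: sum_subtractf)
  also have "\<dots> = (\<Sum>n\<in>A. (real N / 2)\<^sup>2 * (exp (- 12) * (13 - h n)))"
    by (simp add: sum_distrib_left mult.assoc)
  also have "\<dots> \<le> (\<Sum>n\<in>A. real (totient n) * real (totient (n + l)))"
  proof (rule sum_mono)
    fix n assume "n \<in> A"
    hence n: "real n \<ge> real N / 2" by (auto simp: A_def)
    \<comment> \<open>tangent of \<open>exp (- t)\<close> at \<open>t = 12\<close>, the bound for the mean of \<open>h\<close> over \<open>A\<close>\<close>
    have "exp (- 12) * (13 - h n) \<le> exp (- 12) * exp (12 - h n)"
      using exp_ge_add_one_self[of "12 - h n"] by (intro mult_left_mono) auto
    also have "\<dots> = exp (- h n)"
      by (simp flip: exp_add)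
    finally have "(real N / 2)\<^sup>2 * (exp (- 12) * (13 - h n)) \<le> (real N / 2)\<^sup>2 * exp (- h n)"
      by (rule mult_left_mono) simp
    also have "\<dots> \<le> (real n * real (n + l)) * exp (- h n)"
      unfolding power2_eq_square using n by (intro mult_right_mono mult_mono) auto
    also have "\<dots> = (real n * exp (- 2 * prime_recip_sum n)) *
                    (real (n + l) * exp (- 2 * prime_recip_sum (n + l)))"
      by (simp add: h_def distrib_left exp_diff exp_minus field_simps exp_add)
    also have "\<dots> \<le> real (totient n) * real (totient (n + l))"
      by (intro mult_mono totient_ge_exp) auto
    finally show "(real N / 2)\<^sup>2 * (exp (- 12) * (13 - h n)) \<le>
                  real (totient n) * real (totient (n + l))" .
  qed
  also have "\<dots> \<le> (\<Sum>n=1..N. real (totient n) * real (totient (n + l)))"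
    using A by (intro sum_mono2) auto
  finally show ?thesis .
qed

theorem corollary4p3:
  fixes l0 :: nat
  assumes "l0 > 0"
  shows "\<exists>C::real. C > 0 \<and>
    (\<exists>e::real \<Rightarrow> real. e \<in> o[at_top](\<lambda>_. 1) \<and>
      (\<forall>\<^sub>F x in at_top.
        (\<Sum>n\<in>{n::nat. 1 \<le> n \<and> real n \<le> x}. real (totient n) * real (totient (n + l0)))
          \<ge> (1 + e x) * (9 / (2 * pi ^ 4)) * (x ^ 3 / C)))"
proof (intro exI conjI)
  \<comment> \<open>Chosen so that \<open>9 / (2 * pi ^ 4 * C)\<close> equals
    \<open>exp (- 12) / 64\<close>, where 64 is the 8 of the finite bound times \<open>2 ^ 3\<close>
    from \<open>N\<close> \<ge> \<open>x / 2\<close>.\<close>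
  define C where "C = 288 * exp 12 / pi ^ 4"
  show "C > 0" by (simp add: C_def)
  show "(\<lambda>_. 0 :: real) \<in> o[at_top](\<lambda>_ :: real. 1 :: real)" by simp
  show "\<forall>\<^sub>F x in at_top.
      (\<Sum>n\<in>{n::nat. 1 \<le> n \<and> real n \<le> x}. real (totient n) * real (totient (n + l0)))
        \<ge> (1 + 0) * (9 / (2 * pi ^ 4)) * (x ^ 3 / C)"
    using eventually_ge_at_top[of "real l0 + 1"]
  proof eventually_elim
    case (elim x)
    define N where "N = nat \<lfloor>x\<rfloor>"
    have "x \<ge> 1" using elim by simp
    have range: "{n::nat. 1 \<le> n \<and> real n \<le> x} = {1..N}"
      using \<open>x \<ge> 1\<close> by (auto simp: N_def le_nat_floor le_nat_iff le_floor_iff)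
    have "l0 \<le> N" using elim by (auto simp: N_def le_nat_iff le_floor_iff)
    have "\<lfloor>x\<rfloor> \<ge> 1" using \<open>x \<ge> 1\<close> by (simp add: le_floor_iff)
    \<comment> \<open>Rounding down loses at most a factor 2: \<open>x < N + 1\<close> \<le>
      \<open>2 * N\<close>.\<close>
    hence "x / 2 \<le> real N" unfolding N_def by linarith
    hence "(x / 2) ^ 3 \<le> real N ^ 3" using \<open>x \<ge> 1\<close> by (intro power_mono) auto
    moreover have "(1 + 0) * (9 / (2 * pi ^ 4)) * (x ^ 3 / C) = exp (- 12) / 8 * (x / 2) ^ 3"
      by (simp add: C_def exp_minus field_simps)
    ultimately have "(1 + 0) * (9 / (2 * pi ^ 4)) * (x ^ 3 / C) \<le> exp (- 12) / 8 * real N ^ 3"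
      by (simp add: mult_left_mono)
    also note sum_totient_shift_ge[OF \<open>l0 \<le> N\<close>]
    finally show ?case unfolding range .
  qed
qed

end
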